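(* Let $n$ be a positive integer, let $v$ be an odd positive integer with $v\ge 2^n$, and put $q=v^{1/n}$ (a real number). Consider Problem 1: maximize $\prod_{i=1}^{n}m_i$ over $m_1,\dots,m_n\in\mathbb{Z}^{+}$ subject to $\prod_{i=1}^{n}(m_i+1)\le v$. Then $$m_1=m_2=\cdots=m_n=\lfloor v^{1/n}-1\rfloor=\lfloor q-1\rfloor$$ is a (sub-optimal, closed-form) feasible solution of Problem 1, namely the one obtained by applying the floor to each coordinate of the maximizer of the relaxation of Problem 1 in which $m_1,\dots,m_n$ range over $\mathbb{R}^{+}$. With this choice of $m_1,\dots,m_n$, the resulting array $\mathbf{P}$ (defined in the context) is a $(K,F,Z,S)$ placement delivery array (PDA) with $$K=q^n,\quad F=2^nq^n,\quad Z=2^n\bigl(q^n-\lfloor q-1\rfloor^n\bigr),\quad S=\lfloor q-1\rfloor^nq^n,$$ which realizes a coded caching scheme with memory ratio $M/N=1-\frac{\lfloor q-1\rfloor^n}{q^n}$ and transmission load $R=\left(\frac{\lfloor q-1\rfloor}{2}\right)^n$.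
   Context: Notation: $[a]=\{1,\dots,a\}$; $\mathbb{Z}_v$ is the ring of integers modulo $v$; $\langle a\rangle_v$ is $a \bmod v$. The resulting array. Given positive integers $m_1,\dots,m_n$ with $\prod_{i=1}^n(m_i+1)\le v$, put $g=2^n$, $b=\prod_{i=1}^n m_i$, $x_1=1$, $x_i=\prod_{j=1}^{i-1}(m_j+1)$ for $2\le i\le n$, and $\mathbf{X}=\mathrm{diag}(x_1,\dots,x_n)$. Let $\mathbf{A}$ be a $g\times n$ matrix whose rows are all the vectors of $\{-1,1\}^n$ and $\mathbf{B}$ an $n\times b$ matrix whose columns are all the vectors of $[m_1]\times\cdots\times[m_n]$ (each once, in any order). Let $\mathbf{D}=\mathbf{A}\mathbf{X}\mathbf{B}=(d_{i,j})$, with entries reduced modulo $v$. The array $\mathbf{P}=(p_{f,k})$, $0\le f\le vg-1$, $0\le k\le v-1$, is defined by $p_{f,k}=(\langle f+k\rangle_v,\,j)$ if $\langle k-f\rangle_v=d_{\lfloor f/v\rfloor+1,\,j}$ in $\mathbb{Z}_v$ for some $j\in[b]$, and $p_{f,k}=*$ otherwise. PDA. An $F\times K$ array $\mathbf{P}=(p_{j,k})$ with entries in $\{*\}\cup\Sigma$, where $\Sigma$ is a symbol set of size $S$ (e.g. $[S]$), is a $(K,F,Z,S)$ PDA if: C1. each column contains exactly $Z$ stars; C2. each symbol of $\Sigma$ occurs at least once; C3. whenever two distinct positions $(j_1,k_1)\ne(j_2,k_2)$ satisfy $p_{j_1,k_1}=p_{j_2,k_2}\neq *$, then $j_1\ne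 j_2$, $k_1\ne k_2$ and $p_{j_1,k_2}=p_{j_2,k_1}=*$. Coded caching. In a $(K,M,N)$ system a server holds $N$ equal-size files ($N$ an arbitrary positive integer) and is connected by an error-free shared (broadcast) link to $K$ users, each having a cache of size $M$ files. In an $F$-division scheme each file $W_n$ is split into $F$ equal-size packets $W_{n,1},\dots,W_{n,F}$ (bit strings); each user caches packets of total size at most $M$ files without knowing the demands; then, for any demand vector $\mathbf{d}\in[N]^K$, the server broadcasts $R_{\mathbf d}F$ coded packets (XORs of packets) so that each user $k$ recovers $W_{d_k}$ from the broadcast and its cache. $M/N$ is the memory ratio and the load is $R=\max_{\mathbf d}R_{\mathbf d}$. A $(K,F,Z,S)$ PDA realizes the scheme in which user $k$ caches packet $j$ of every file exactly when $p_{j,k}=*$, and for every non-star symbol $s$ the server sends $\bigoplus_{(j,k):\,p_{j,k}=s}W_{d_k,j}$; thus $M/N=Z/F$ and $R=S/F$. *)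

theory Defs
  imports Complex_Main "HOL-Library.FuncSet" "HOL-Library.Multiset" "HOL-Library.Z2"
    "Jordan_Normal_Form.Matrix"
begin

text \<open>
  All index sets start at 0: coordinates are \<open>i < n\<close>, array rows (packets) \<open>j < F\<close>,
  array columns (users) \<open>k < K\<close>, and files \<open>a < N\<close>.
\<close>

section \<open>The optimization problem and its relaxation\<close>

text \<open>
  At type \<^typ>\<open>nat\<close> the constraint set is that of the integer problem, at type \<^typ>\<open>real\<close>
  that of its relaxation.  Only the values at indices below \<open>n\<close> matter.
\<close>

definition objective :: "nat \<Rightarrow> (nat \<Rightarrow> 'a::linordered_semidom) \<Rightarrow> 'a" where
  "objective n m = (\<Prod>i<n. m i)"

definition feasible :: "nat \<Rightarrow> nat \<Rightarrow> (nat \<Rightarrow> 'a::linordered_semidom) \<Rightarrow> bool" where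
  "feasible n v m \<longleftrightarrow> (\<forall>i<n. 0 < m i) \<and> (\<Prod>i<n. m i + 1) \<le> of_nat v"

definition relaxed_maximizer :: "nat \<Rightarrow> nat \<Rightarrow> (nat \<Rightarrow> real) \<Rightarrow> bool" where
  "relaxed_maximizer n v y \<longleftrightarrow> is_arg_max (objective n) (feasible n v) y"

section \<open>Placement delivery arrays\<close>

text \<open>\<^term>\<open>None\<close> is the star.\<close>

type_synonym 's array = "nat \<Rightarrow> nat \<Rightarrow> 's option"

definition pda :: "nat \<Rightarrow> nat \<Rightarrow> nat \<Rightarrow> nat \<Rightarrow> 's set \<Rightarrow> 's array \<Rightarrow> bool" where
  "pda K F Z S \<Sigma> P \<longleftrightarrow>
     finite \<Sigma> \<and> card \<Sigma> = S \<and>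
     (\<forall>j<F. \<forall>k<K. P j k \<in> insert None (Some ` \<Sigma>)) \<and>
     (\<forall>k<K. card {j. j < F \<and> P j k = None} = Z) \<and>
     (\<forall>s\<in>\<Sigma>. \<exists>j<F. \<exists>k<K. P j k = Some s) \<and>
     (\<forall>j1<F. \<forall>k1<K. \<forall>j2<F. \<forall>k2<K.
        (j1, k1) \<noteq> (j2, k2) \<and> P j1 k1 = P j2 k2 \<and> P j1 k1 \<noteq> None \<longrightarrow>
        j1 \<noteq> j2 \<and> k1 \<noteq> k2 \<and> P j1 k2 = None \<and> P j2 k1 = None)"

section \<open>The resulting array\<close>

definition enumerates_signs :: "nat \<Rightarrow> int mat \<Rightarrow> bool" where
  "enumerates_signs n A \<longleftrightarrow>
     A \<in> carrier_mat (2 ^ n) n \<and> distinct (rows A) \<and>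
     set (rows A) = {w \<in> carrier_vec n. \<forall>i<n. w $ i \<in> {-1, 1}}"

definition enumerates_box :: "nat \<Rightarrow> (nat \<Rightarrow> nat) \<Rightarrow> int mat \<Rightarrow> bool" where
  "enumerates_box n m B \<longleftrightarrow>
     B \<in> carrier_mat n (\<Prod>i<n. m i) \<and> distinct (cols B) \<and>
     set (cols B) = {w \<in> carrier_vec n. \<forall>i<n. w $ i \<in> {1..int (m i)}}"

definition weight :: "(nat \<Rightarrow> nat) \<Rightarrow> nat \<Rightarrow> int" where
  "weight m i = (\<Prod>j<i. int (m j) + 1)"

definition D_mat :: "nat \<Rightarrow> nat \<Rightarrow> (nat \<Rightarrow> nat) \<Rightarrow> int mat \<Rightarrow> int mat \<Rightarrow> int mat" where
  "D_mat n v m A B = map_mat (\<lambda>d. d mod int v) (A * mat_diag n (weight m) * B)"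

text \<open>
  \<open>THE\<close> presupposes that each row of \<open>D\<close> has distinct entries modulo \<open>v\<close>; this holds
  whenever \<open>m\<close> is feasible.
\<close>

definition result_array ::
    "nat \<Rightarrow> nat \<Rightarrow> (nat \<Rightarrow> nat) \<Rightarrow> int mat \<Rightarrow> int mat \<Rightarrow> (nat \<times> nat) array" where
  "result_array n v m A B f k =
     (let hit = (\<lambda>j. j < (\<Prod>i<n. m i) \<and>
                     (int k - int f) mod int v = D_mat n v m A B $$ (f div v, j))
      in if \<exists>j. hit j then Some ((f + k) mod v, THE j. hit j) else None)"

section \<open>Coded caching\<close>

text \<open>
  A packet is a list of \<open>L\<close> bits, and \<open>W (a, j)\<close> is packet \<open>j\<close> of file \<open>a\<close>.  Addition on
  \<^typ>\<open>bit\<close> is exclusive or.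
\<close>

type_synonym packet = "bit list"

definition libraries :: "nat \<Rightarrow> nat \<Rightarrow> nat \<Rightarrow> (nat \<times> nat \<Rightarrow> packet) set" where
  "libraries N F L = {W. \<forall>a<N. \<forall>j<F. length (W (a, j)) = L}"

definition xor_packets ::
    "nat \<Rightarrow> (nat \<times> nat \<Rightarrow> packet) \<Rightarrow> (nat \<times> nat) multiset \<Rightarrow> packet" where
  "xor_packets L W T = map (\<lambda>i. \<Sum>x\<in>#T. W x ! i) [0..<L]"

definition demands :: "nat \<Rightarrow> nat \<Rightarrow> (nat \<Rightarrow> nat) set" where
  "demands K N = {..<K} \<rightarrow>\<^sub>E {..<N}"

text \<open>
  For demand \<open>d\<close> the server sends one coded packet for each \<open>s \<in> signals sch d\<close>, the XOR of
  the packets listed in \<open>coded sch d s\<close>.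
\<close>

record 's scheme =
  cached :: "nat \<Rightarrow> (nat \<times> nat) set"
  signals :: "(nat \<Rightarrow> nat) \<Rightarrow> 's set"
  coded :: "(nat \<Rightarrow> nat) \<Rightarrow> 's \<Rightarrow> (nat \<times> nat) multiset"

text \<open>
  Sizes are in units of files, so that a packet has size \<open>1 / F\<close>.  The decoder \<open>dec\<close> of a
  user may depend on the demand vector, but sees the library only through the broadcast and
  the user's own cache.
\<close>

definition coded_caching_scheme ::
    "nat \<Rightarrow> real \<Rightarrow> nat \<Rightarrow> nat \<Rightarrow> 's scheme \<Rightarrow> bool" where
  "coded_caching_scheme K M N F sch \<longleftrightarrow>
     (\<forall>k<K. cached sch k \<subseteq> {..<N} \<times> {..<F} \<and> real (card (cached sch k)) / real F \<le> M) \<and>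
     (\<forall>d\<in>demands K N. finite (signals sch d) \<and>
        (\<forall>s\<in>signals sch d. set_mset (coded sch d s) \<subseteq> {..<N} \<times> {..<F})) \<and>
     (\<forall>L. \<forall>d\<in>demands K N. \<forall>k<K.
        \<exists>dec :: ('s \<Rightarrow> packet) \<Rightarrow> (nat \<times> nat \<Rightarrow> packet) \<Rightarrow> nat \<Rightarrow> packet.
          \<forall>W\<in>libraries N F L. \<forall>j<F.
            dec (\<lambda>s\<in>signals sch d. xor_packets L W (coded sch d s))
                (restrict W (cached sch k)) j = W (d k, j))"

definition cache_size :: "nat \<Rightarrow> nat \<Rightarrow> 's scheme \<Rightarrow> real" where
  "cache_size K F sch = Max ((\<lambda>k. real (card (cached sch k)) / real F) ` {..<K})"

definition load :: "nat \<Rightarrow> nat \<Rightarrow> nat \<Rightarrow> 's scheme \<Rightarrow> real" where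
  "load K N F sch = Max ((\<lambda>d. real (card (signals sch d)) / real F) ` demands K N)"

definition pda_scheme :: "nat \<Rightarrow> nat \<Rightarrow> nat \<Rightarrow> 's set \<Rightarrow> 's array \<Rightarrow> 's scheme" where
  "pda_scheme K N F \<Sigma> P =
     \<lparr> cached = (\<lambda>k. {(a, j). a < N \<and> j < F \<and> P j k = None}),
       signals = (\<lambda>d. \<Sigma>),
       coded = (\<lambda>d s. image_mset (\<lambda>(j, k). (d k, j))
                        (mset_set {(j, k). j < F \<and> k < K \<and> P j k = Some s})) \<rparr>"

end

theory Submission
  imports Defs
begin

text \<open>
  For the relaxation, weighted AM-GM gives
  \<open>(y / (q - 1)) powr ((q - 1) / q) \<le> (y + 1) / q\<close>, with equality only at \<open>y = q - 1\<close>;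
  multiplying over the coordinates bounds the objective.

  For the array, the weights are those of the mixed-radix system with bases \<open>m i + 1\<close>.
  Hence a combination of the weights with coefficients \<open>\<bar>c i\<bar> \<le> m i\<close> is smaller than \<open>v\<close>
  in absolute value, and it vanishes modulo \<open>v\<close> only if all \<open>c i\<close> vanish.  Since \<open>v\<close> is odd,
  congruences may be halved, and every condition on the array turns into the vanishing of
  such a combination.  In particular a violation of the third PDA condition would give
  \<open>2 d(r, j') \<equiv> d(r, j) + d(r', j)\<close> with distinct sign vectors \<open>r\<close>, \<open>r'\<close>; where these
  differ, the halved digit is \<open>\<plusminus> B(i, j')\<close>, which is nonzero because the entries of \<open>B\<close>
  start at 1.
\<close>

section \<open>The relaxed problem\<close>

text \<open>The point \<open>w = (y + 1) / q\<close> is the convex combination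
  \<open>s * a + (1 - s) * 1\<close>, so this is concavity of \<open>ln\<close>. It is proved from
  the tangent bound \<open>ln t \<le> t - 1\<close> at \<open>a / w\<close> and
  \<open>1 / w\<close>, which also isolates the equality case.\<close>

lemma log_gap:
  fixes q y :: real
  assumes "q > 1" "y > 0"
  shows "(q - 1) / q * ln (y / (q - 1)) \<le> ln ((y + 1) / q)"
    and "(q - 1) / q * ln (y / (q - 1)) = ln ((y + 1) / q) \<Longrightarrow> y = q - 1"
proof -
  define s where "s = (q - 1) / q"
  define a where "a = y / (q - 1)"
  define w where "w = (y + 1) / q"
  have pos: "a > 0" "w > 0" "0 < s" "s < 1"
    using assms by (auto simp: a_def w_def s_def)
  have sw: "s * a + (1 - s) = w"
    using assms by (simp add: s_def a_def w_def field_simps)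
  have 1: "ln (a / w) \<le> a / w - 1" "ln (1 / w) \<le> 1 / w - 1"
    using pos by (auto intro!: ln_le_minus_one)
  have split: "s * ln a - ln w = s * ln (a / w) + (1 - s) * ln (1 / w)"
    using pos by (simp add: ln_div algebra_simps)
  have "s * (a / w - 1) + (1 - s) * (1 / w - 1) = (s * a + (1 - s)) / w - 1"
    using pos by (simp add: field_simps)
  hence bal: "s * (a / w - 1) + (1 - s) * (1 / w - 1) = 0"
    using sw pos by simp
  have 2: "s * ln (a / w) \<le> s * (a / w - 1)" "(1 - s) * ln (1 / w) \<le> (1 - s) * (1 / w - 1)"
    using 1 pos by (auto intro!: mult_left_mono)
  show "(q - 1) / q * ln (y / (q - 1)) \<le> ln ((y + 1) / q)"
    using split bal 2 unfolding s_def[symmetric] a_def[symmetric] w_def[symmetric] by linarith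
  assume "(q - 1) / q * ln (y / (q - 1)) = ln ((y + 1) / q)"
  hence "s * ln a - ln w = 0"
    unfolding s_def a_def w_def by simp
  \<comment> \<open>Two inequalities whose sum is an equality are both equalities; the second alone
    forces \<open>w = 1\<close>.\<close>
  hence "(1 - s) * ln (1 / w) = (1 - s) * (1 / w - 1)"
    using split bal 2 by linarith
  hence "ln (1 / w) = 1 / w - 1" using pos by simp
  hence "1 / w = 1" using pos by (intro ln_eq_minus_one) auto
  thus "y = q - 1" using assms by (simp add: w_def field_simps)
qed

text \<open>Summing \<open>log_gap\<close> over the coordinates compares the logarithm of the
  normalised objective with that of the normalised constraint product, which is at most 0 by
  feasibility.\<close>

lemma feasible_objective_le:
  fixes y :: "nat \<Rightarrow> real"
  assumes "q > 1" "q ^ n = real v" "feasible n v y"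
  shows "objective n y \<le> (q - 1) ^ n"
    and "objective n y = (q - 1) ^ n \<Longrightarrow> i < n \<Longrightarrow> y i = q - 1"
proof -
  let ?l = "\<lambda>i. (q - 1) / q * ln (y i / (q - 1))" and ?r = "\<lambda>i. ln ((y i + 1) / q)"
  have pos: "y i > 0" if "i < n" for i
    using assms that by (auto simp: feasible_def)
  have le: "(\<Sum>i<n. ?l i) \<le> (\<Sum>i<n. ?r i)"
    by (intro sum_mono log_gap) (use assms pos in auto)
  have "(\<Prod>i<n. (y i + 1) / q) \<le> 1"
    using assms by (simp add: prod_dividef feasible_def divide_le_eq)
  moreover have "(\<Prod>i<n. (y i + 1) / q) > 0"
    using assms pos by (intro prod_pos) (auto simp: add_pos_pos)
  moreover have "(\<Sum>i<n. ?r i) = ln (\<Prod>i<n. (y i + 1) / q)"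
    using assms(1) pos by (intro ln_prod[symmetric]) (force simp: add_pos_pos)+
  ultimately have r0: "(\<Sum>i<n. ?r i) \<le> 0" by simp
  have ppos: "(\<Prod>i<n. y i / (q - 1)) > 0"
    using assms pos by (intro prod_pos) auto
  have lsum: "(\<Sum>i<n. ?l i) = (q - 1) / q * ln (\<Prod>i<n. y i / (q - 1))"
    using assms(1) pos by (subst ln_prod) (force simp: sum_distrib_left)+
  have "(q - 1) / q * ln (\<Prod>i<n. y i / (q - 1)) \<le> 0"
    using le r0 lsum by linarith
  hence "ln (\<Prod>i<n. y i / (q - 1)) \<le> 0"
    using assms(1) by (simp add: mult_le_0_iff divide_le_0_iff)
  hence "(\<Prod>i<n. y i / (q - 1)) \<le> 1"
    using ppos by simp
  thus "objective n y \<le> (q - 1) ^ n"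
    using assms(1) by (simp add: objective_def prod_dividef divide_le_eq)
  assume eq: "objective n y = (q - 1) ^ n" and "i < n"
  have "(\<Prod>i<n. y i / (q - 1)) = 1"
    using eq assms(1) by (simp add: objective_def prod_dividef)
  hence "(\<Sum>i<n. ?l i) = 0" using lsum by simp
  \<comment> \<open>Here \<open>0 = sum ?l \<le> sum ?r \<le> 0\<close>. The gaps are nonnegative,
    so each one vanishes.\<close>
  hence "(\<Sum>i<n. ?r i - ?l i) = 0" using le r0 by (simp add: sum_subtractf)
  moreover have "?r i - ?l i \<ge> 0" if "i < n" for i
    using log_gap(1)[OF assms(1) pos[OF that]] by simp
  ultimately have "?r i - ?l i = 0"
    using \<open>i < n\<close> by (subst (asm) sum_nonneg_eq_0_iff) auto
  thus "y i = q - 1"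
    using log_gap(2)[OF assms(1) pos[OF \<open>i < n\<close>]] by simp
qed

text \<open>The constant point attains the bound, and the equality case gives uniqueness, so one may
  speak of the maximizer whose coordinates are floored. Values at indices from \<open>n\<close> on
  stay free.\<close>

lemma relaxed_maximizer_iff:
  assumes "q > 1" "q ^ n = real v"
  shows "relaxed_maximizer n v y \<longleftrightarrow> (\<forall>i<n. y i = q - 1)"
proof
  have fe: "feasible n v (\<lambda>i. q - 1)"
    using assms by (simp add: feasible_def)
  have ob: "objective n (\<lambda>i. q - 1) = (q - 1) ^ n"
    by (simp add: objective_def)
  {
    assume "relaxed_maximizer n v y"
    hence f: "feasible n v y" and "\<not> objective n (\<lambda>i. q - 1) > objective n y"
      using fe by (auto simp: relaxed_maximizer_def is_arg_max_def)
    hence "objective n y = (q - 1) ^ n"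
      using ob feasible_objective_le(1)[OF assms f] by linarith
    thus "\<forall>i<n. y i = q - 1"
      using feasible_objective_le(2)[OF assms f] by blast
  next
    assume y: "\<forall>i<n. y i = q - 1"
    hence "feasible n v y \<longleftrightarrow> feasible n v (\<lambda>i. q - 1)"
      "objective n y = objective n (\<lambda>i. q - 1)"
      by (simp_all add: feasible_def objective_def)
    thus "relaxed_maximizer n v y"
      using fe ob feasible_objective_le(1)[OF assms]
      by (auto simp: relaxed_maximizer_def is_arg_max_def not_less)
  }
qed

section \<open>Mixed-radix representations with signed digits\<close>

lemma weight_Suc: "weight m (Suc n) = weight m n * (int (m n) + 1)"
  by (simp add: weight_def)

lemma weight_pos: "weight m n > 0"
  by (auto simp: weight_def intro!: prod_pos)

text \<open>The analogue of all nines in base ten: each term is the difference of two consecutive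
  weights, so the sum telescopes.\<close>

lemma sum_weight: "(\<Sum>i<n. weight m i * int (m i)) = weight m n - 1"
  by (induction n) (simp_all add: weight_Suc algebra_simps, simp add: weight_def)

lemma abs_signed_digits_less:
  assumes "\<forall>i<n. \<bar>c i\<bar> \<le> int (m i)"
  shows "\<bar>\<Sum>i<n. weight m i * c i\<bar> < weight m n"
proof -
  have "\<bar>\<Sum>i<n. weight m i * c i\<bar> \<le> (\<Sum>i<n. weight m i * int (m i))"
    using assms weight_pos[of m, THEN less_imp_le]
    by (intro order_trans[OF sum_abs] sum_mono) (simp add: abs_mult mult_left_mono)
  thus ?thesis by (simp add: sum_weight)
qed

text \<open>The lower digits together stay below \<open>weight m n\<close> in absolute value, so
  they cannot cancel a nonzero top digit; induction removes the digits one by one.\<close>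

lemma signed_digits_eq_0:
  assumes "\<forall>i<n. \<bar>c i\<bar> \<le> int (m i)" "(\<Sum>i<n. weight m i * c i) = 0"
  shows "\<forall>i<n. c i = 0"
  using assms
proof (induction n)
  case (Suc n)
  have "\<bar>\<Sum>i<n. weight m i * c i\<bar> < weight m n"
    using Suc.prems(1) by (intro abs_signed_digits_less) simp
  moreover have "(\<Sum>i<n. weight m i * c i) = - (weight m n * c n)"
    using Suc.prems(2) by simp
  ultimately have "weight m n * \<bar>c n\<bar> < weight m n * 1"
    using weight_pos[of m n] by (simp add: abs_mult)
  hence "c n = 0"
    unfolding mult_less_cancel_left_pos[OF weight_pos] by simp
  moreover from this have "\<forall>i<n. c i = 0"
    using Suc.prems by (intro Suc.IH) auto
  ultimately show ?case by (simp add: less_Suc_eq)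
qed simp

text \<open>Feasibility says \<open>weight m n \<le> v\<close>, so the only multiple of
  \<open>v\<close> within reach of such a combination is 0.\<close>

lemma signed_digits_dvd:
  assumes "feasible n v m" "\<forall>i<n. \<bar>c i\<bar> \<le> int (m i)"
    and "int v dvd (\<Sum>i<n. weight m i * c i)"
  shows "\<forall>i<n. c i = 0"
proof (rule signed_digits_eq_0[OF assms(2)])
  have "weight m n = int (\<Prod>i<n. m i + 1)"
    by (simp add: weight_def add.commute)
  hence "weight m n \<le> int v"
    using assms(1) unfolding feasible_def of_nat_id by linarith
  hence "\<bar>\<Sum>i<n. weight m i * c i\<bar> < int v"
    using abs_signed_digits_less[OF assms(2)] by linarith
  thus "(\<Sum>i<n. weight m i * c i) = 0"
    using assms(3) dvd_imp_le_int[of "\<Sum>i<n. weight m i * c i" "int v"] by linarith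
qed

section \<open>The resulting array\<close>

text \<open>The PDA property is developed for an arbitrary feasible \<open>m\<close>; the floored
  choice enters only in the final theorem.\<close>

locale caching_array =
  fixes n v :: nat and m :: "nat \<Rightarrow> nat" and A B :: "int mat"
  assumes odd_v: "odd v" and feas: "feasible n v m"
    and signs: "enumerates_signs n A" and box: "enumerates_box n m B"
begin

abbreviation b :: nat where "b \<equiv> \<Prod>i<n. m i"

text \<open>The entry of \<open>A X B\<close> before reduction modulo \<open>v\<close>.\<close>

definition e :: "nat \<Rightarrow> nat \<Rightarrow> int" where
  "e r j = (\<Sum>i<n. weight m i * (A $$ (r, i) * B $$ (i, j)))"

text \<open>The local \<open>hit\<close> of \<open>result_array\<close> as a divisibility, so that
  several conditions can be combined linearly.\<close>

definition hit :: "nat \<Rightarrow> nat \<Rightarrow> nat \<Rightarrow> bool" where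
  "hit f k j \<longleftrightarrow> j < b \<and> int v dvd int k - int f - e (f div v) j"

section \<open>Entries of the two enumerating matrices\<close>

lemma v_pos: "v > 0"
  using odd_v by (cases v) auto

lemma A_entry:
  assumes "r < 2 ^ n" "i < n"
  shows "A $$ (r, i) = 1 \<or> A $$ (r, i) = -1"
proof -
  have "row A r \<in> set (rows A)"
    using assms signs by (auto simp: enumerates_signs_def rows_def)
  hence "row A r $ i \<in> {-1, 1}"
    using assms signs by (simp add: enumerates_signs_def)
  thus ?thesis
    using assms signs by (auto simp: enumerates_signs_def)
qed

lemma B_entry:
  assumes "j < b" "i < n"
  shows "B $$ (i, j) \<in> {1..int (m i)}"
proof -
  have "col B j \<in> set (cols B)"
    using assms box by (auto simp: enumerates_box_def cols_def)
  hence "col B j $ i \<in> {1..int (m i)}"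
    using assms box by (simp add: enumerates_box_def)
  thus ?thesis
    using assms box by (auto simp: enumerates_box_def)
qed

lemma A_rows_differ:
  assumes "r < 2 ^ n" "r' < 2 ^ n" "r \<noteq> r'"
  obtains i where "i < n" "A $$ (r, i) \<noteq> A $$ (r', i)"
proof -
  have "distinct (rows A)" "r < length (rows A)" "r' < length (rows A)"
    using assms signs by (auto simp: enumerates_signs_def)
  hence "row A r \<noteq> row A r'"
    using assms(3) by (metis length_rows nth_rows nth_eq_iff_index_eq)
  hence "\<exists>i<n. A $$ (r, i) \<noteq> A $$ (r', i)"
    using assms signs by (auto simp: enumerates_signs_def vec_eq_iff)
  thus thesis using that by blast
qed

lemma B_cols_differ:
  assumes "j < b" "j' < b" "j \<noteq> j'"
  obtains i where "i < n" "B $$ (i, j) \<noteq> B $$ (i, j')"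
proof -
  have "distinct (cols B)" "j < length (cols B)" "j' < length (cols B)"
    using assms box by (auto simp: enumerates_box_def)
  hence "col B j \<noteq> col B j'"
    using assms(3) by (metis cols_length cols_nth nth_eq_iff_index_eq)
  hence "\<exists>i<n. B $$ (i, j) \<noteq> B $$ (i, j')"
    using assms box by (auto simp: enumerates_box_def vec_eq_iff)
  thus thesis using that by blast
qed

lemma D_mat_entry:
  assumes "r < 2 ^ n" "j < b"
  shows "D_mat n v m A B $$ (r, j) = e r j mod int v"
proof -
  have A: "A \<in> carrier_mat (2 ^ n) n" and B: "B \<in> carrier_mat n b"
    using signs box by (auto simp: enumerates_signs_def enumerates_box_def)
  have "(A * mat_diag n (weight m) * B) $$ (r, j) = e r j"
    using A B assms
    by (auto simp: mat_diag_mult_right[OF A] scalar_prod_def e_def lessThan_atLeast0 ac_simps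
        intro!: sum.cong)
  thus ?thesis
    using A B assms by (simp add: D_mat_def)
qed

section \<open>Separation of the entries of \<open>D\<close> modulo the odd number
  \<open>v\<close>\<close>

lemma dvd_double_cancel: "int v dvd 2 * x \<Longrightarrow> int v dvd x"
  using odd_v by (metis coprime_dvd_mult_right_iff coprime_right_2_iff_odd even_of_nat)

text \<open>Both terms carry the same signs, so each digit is a sign times a difference of two
  values in \<open>{1..m i}\<close>, hence below \<open>m i\<close> in absolute value.\<close>

lemma e_inj_col:
  assumes "r < 2 ^ n" "j < b" "j' < b" "int v dvd e r j - e r j'"
  shows "j = j'"
proof (rule ccontr)
  assume "j \<noteq> j'"
  then obtain i where i: "i < n" "B $$ (i, j) \<noteq> B $$ (i, j')"
    using B_cols_differ assms by blast
  let ?c = "\<lambda>i. A $$ (r, i) * (B $$ (i, j) - B $$ (i, j'))"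
  have bound: "\<forall>i<n. \<bar>?c i\<bar> \<le> int (m i)"
  proof (intro allI impI)
    fix i assume i: "i < n"
    show "\<bar>?c i\<bar> \<le> int (m i)"
      using A_entry[OF assms(1) i] B_entry[OF assms(2) i] B_entry[OF assms(3) i] by (elim disjE) auto
  qed
  have eq: "e r j - e r j' = (\<Sum>i<n. weight m i * ?c i)"
    unfolding e_def sum_subtractf[symmetric] by (intro sum.cong) (auto simp: algebra_simps)
  have "int v dvd (\<Sum>i<n. weight m i * ?c i)"
    using assms(4) unfolding eq .
  hence "?c i = 0"
    using signed_digits_dvd[OF feas bound] i(1) by blast
  thus False using i A_entry[OF assms(1) i(1)] by auto
qed

lemma e_inj_row:
  assumes "r < 2 ^ n" "r' < 2 ^ n" "j < b" "int v dvd e r j - e r' j"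
  shows "r = r'"
proof (rule ccontr)
  assume "r \<noteq> r'"
  then obtain i where i: "i < n" "A $$ (r, i) \<noteq> A $$ (r', i)"
    using A_rows_differ assms by blast
  \<comment> \<open>Two signs differ by 0 or 2 in absolute value, so \<open>div 2\<close> is exact.
    The digits without the factor 2 fit the bound \<open>m i\<close>.\<close>
  let ?c = "\<lambda>i. (A $$ (r, i) - A $$ (r', i)) div 2 * B $$ (i, j)"
  have bound: "\<forall>i<n. \<bar>?c i\<bar> \<le> int (m i)"
  proof (intro allI impI)
    fix i assume i: "i < n"
    show "\<bar>?c i\<bar> \<le> int (m i)"
      using A_entry[OF assms(1) i] A_entry[OF assms(2) i] B_entry[OF assms(3) i] by (elim disjE) auto
  qed
  have eq: "e r j - e r' j = 2 * (\<Sum>i<n. weight m i * ?c i)"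
    unfolding e_def sum_subtractf[symmetric] sum_distrib_left
  proof (intro sum.cong refl)
    fix i assume "i \<in> {..<n}"
    hence i: "i < n" by simp
    show "weight m i * (A $$ (r, i) * B $$ (i, j)) - weight m i * (A $$ (r', i) * B $$ (i, j))
        = 2 * (weight m i * ?c i)"
      using A_entry[OF assms(1) i] A_entry[OF assms(2) i] by (elim disjE) auto
  qed
  have "int v dvd (\<Sum>i<n. weight m i * ?c i)"
    using assms(4) unfolding eq by (rule dvd_double_cancel)
  hence "?c i = 0"
    using signed_digits_dvd[OF feas bound] i(1) by blast
  thus False
    using i A_entry[OF assms(1) i(1)] A_entry[OF assms(2) i(1)] B_entry[OF assms(3) i(1)] by auto
qed

lemma e_midpoint:
  assumes "r < 2 ^ n" "r' < 2 ^ n" "j < b" "j' < b"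
    and "int v dvd 2 * e r j' - (e r j + e r' j)"
  shows "r = r'"
proof (rule ccontr)
  assume "r \<noteq> r'"
  then obtain i where i: "i < n" "A $$ (r, i) \<noteq> A $$ (r', i)"
    using A_rows_differ assms by blast
  \<comment> \<open>Where the signs agree, the digit is a sign times a difference of two box
    entries. Where they differ, their mean is 0 and a signed box entry remains.\<close>
  let ?c = "\<lambda>i. A $$ (r, i) * B $$ (i, j') - (A $$ (r, i) + A $$ (r', i)) div 2 * B $$ (i, j)"
  have bound: "\<forall>i<n. \<bar>?c i\<bar> \<le> int (m i)"
  proof (intro allI impI)
    fix i assume i: "i < n"
    show "\<bar>?c i\<bar> \<le> int (m i)"
      using A_entry[OF assms(1) i] A_entry[OF assms(2) i] B_entry[OF assms(3) i]
        B_entry[OF assms(4) i] by (elim disjE) auto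
  qed
  have eq: "2 * e r j' - (e r j + e r' j) = 2 * (\<Sum>i<n. weight m i * ?c i)"
    unfolding e_def sum_distrib_left sum.distrib[symmetric] sum_subtractf[symmetric]
  proof (intro sum.cong refl)
    fix i assume "i \<in> {..<n}"
    hence i: "i < n" by simp
    show "2 * (weight m i * (A $$ (r, i) * B $$ (i, j'))) - (weight m i * (A $$ (r, i) * B $$ (i, j))
          + weight m i * (A $$ (r', i) * B $$ (i, j))) = 2 * (weight m i * ?c i)"
      using A_entry[OF assms(1) i] A_entry[OF assms(2) i]
      by (elim disjE) (auto simp: algebra_simps)
  qed
  have "int v dvd (\<Sum>i<n. weight m i * ?c i)"
    using assms(5) unfolding eq by (rule dvd_double_cancel)
  hence "?c i = 0"
    using signed_digits_dvd[OF feas bound] i(1) by blast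
  thus False
    using i A_entry[OF assms(1) i(1)] A_entry[OF assms(2) i(1)] B_entry[OF assms(4) i(1)] by auto
qed

section \<open>Filled cells of the array\<close>

lemma div_v_less: "f < 2 ^ n * v \<Longrightarrow> f div v < 2 ^ n"
  using v_pos by (simp add: div_less_iff_less_mult)

text \<open>Two hits in one cell make two entries of one row of \<open>D\<close> congruent. This
  justifies the \<open>THE\<close> in \<open>result_array\<close>.\<close>

lemma hit_unique:
  assumes "f < 2 ^ n * v" "hit f k j" "hit f k j'"
  shows "j = j'"
proof -
  have "int v dvd (int k - int f - e (f div v) j') - (int k - int f - e (f div v) j)"
    using assms(2,3) unfolding hit_def by (blast intro: dvd_diff)
  thus ?thesis
    using assms e_inj_col[OF div_v_less[OF assms(1)], of j j'] by (simp add: hit_def)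
qed

lemma result_array_eq:
  assumes "f < 2 ^ n * v"
  shows "result_array n v m A B f k =
    (if \<exists>j. hit f k j then Some ((f + k) mod v, THE j. hit f k j) else None)"
proof -
  have "(\<lambda>j. j < b \<and> (int k - int f) mod int v = D_mat n v m A B $$ (f div v, j)) = hit f k"
    using D_mat_entry[OF div_v_less[OF assms]] by (auto simp: hit_def fun_eq_iff mod_eq_dvd_iff)
  thus ?thesis by (simp add: result_array_def Let_def)
qed

lemma result_array_Some_iff:
  assumes "f < 2 ^ n * v"
  shows "result_array n v m A B f k = Some (s, j) \<longleftrightarrow> s = (f + k) mod v \<and> hit f k j"
  using hit_unique[OF assms] by (auto simp: result_array_eq[OF assms] intro: theI the_equality)

lemma result_array_None_iff:
  assumes "f < 2 ^ n * v"
  shows "result_array n v m A B f k = None \<longleftrightarrow> (\<forall>j. \<not> hit f k j)"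
  by (simp add: result_array_eq[OF assms])

text \<open>In a fixed column, block \<open>r\<close> of \<open>v\<close> consecutive rows has
  exactly one row hit by index \<open>j\<close>, namely the one at offset \<open>k - e r j\<close>
  modulo \<open>v\<close>. So \<open>g\<close> is a bijection from pairs \<open>(r, j)\<close> to
  filled rows.\<close>

lemma card_hits: "card {f. f < 2 ^ n * v \<and> (\<exists>j. hit f k j)} = 2 ^ n * b"
proof -
  define g where "g = (\<lambda>(r, j). r * v + nat ((int k - e r j) mod int v))"
  have res: "nat ((int k - e r j) mod int v) < v" for r j
    using v_pos by (simp add: nat_less_iff)
  have row: "g (r, j) div v = r" for r j
    using res[of r j] by (simp add: g_def)
  have hitg: "hit (g (r, j)) k j" if "j < b" for r j
  proof -
    have "int k - int (g (r, j)) - e r j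
        = (int k - e r j) - (int k - e r j) mod int v - int r * int v"
      using v_pos by (simp add: g_def)
    hence "int v dvd int k - int (g (r, j)) - e r j"
      by (metis dvd_diff dvd_minus_mod dvd_triv_right)
    thus ?thesis using that row by (simp add: hit_def)
  qed
  have less: "g (r, j) < 2 ^ n * v" if "r < 2 ^ n" for r j
  proof -
    have "g (r, j) < (r + 1) * v" using res[of r j] by (simp add: g_def)
    also have "\<dots> \<le> 2 ^ n * v" using that by (intro mult_right_mono) auto
    finally show ?thesis .
  qed
  have "inj_on g ({..<2 ^ n} \<times> {..<b})"
  proof (rule inj_onI, clarsimp)
    fix r j r' j' assume *: "r < 2 ^ n" "j < b" "r' < 2 ^ n" "j' < b" "g (r, j) = g (r', j')"
    from * have "r = r'" using row by metis
    moreover have "j = j'"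
      using * hit_unique[OF less] hitg by metis
    ultimately show "r = r' \<and> j = j'" by simp
  qed
  moreover have "{f. f < 2 ^ n * v \<and> (\<exists>j. hit f k j)} = g ` ({..<2 ^ n} \<times> {..<b})"
  proof (intro equalityI subsetI)
    fix f assume "f \<in> {f. f < 2 ^ n * v \<and> (\<exists>j. hit f k j)}"
    then obtain j where f: "f < 2 ^ n * v" "hit f k j" by blast
    let ?x = "int k - e (f div v) j"
    have "?x mod int v = int f mod int v"
      using f(2) by (simp add: hit_def mod_eq_dvd_iff algebra_simps)
    hence "g (f div v, j) = f"
      using v_pos by (simp add: g_def nat_mod_distrib)
    moreover have "f div v < 2 ^ n" "j < b"
      using f div_v_less by (auto simp: hit_def)
    ultimately show "f \<in> g ` ({..<2 ^ n} \<times> {..<b})"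
      by (metis SigmaI image_eqI lessThan_iff)
  next
    fix f assume "f \<in> g ` ({..<2 ^ n} \<times> {..<b})"
    thus "f \<in> {f. f < 2 ^ n * v \<and> (\<exists>j. hit f k j)}" using less hitg by blast
  qed
  ultimately show ?thesis by (simp add: card_image card_cartesian_product)
qed

text \<open>Block 0 suffices: the system \<open>f + k = s\<close>, \<open>k - f = e 0 j\<close>
  modulo \<open>v\<close> is solvable because 2 is invertible.\<close>

lemma symbol_occurs:
  assumes "s < v" "j < b"
  obtains f k where "f < v" "k < v" "(f + k) mod v = s" "hit f k j"
proof -
  \<comment> \<open>\<open>h\<close> is the inverse of 2 modulo \<open>v\<close>; adding the two
    congruences gives \<open>2 * k = s + e 0 j\<close>, which determines \<open>k\<close>.\<close>
  obtain h where h: "int v + 1 = 2 * h"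
    using odd_v by (metis even_of_nat evenE odd_even_add odd_one)
  let ?V = "int v" and ?x = "(int s + e 0 j) * h"
  define k where "k = nat (?x mod ?V)"
  define f where "f = nat ((int s - int k) mod ?V)"
  have kf: "int k = ?x mod ?V" "int f = (int s - int k) mod ?V"
    using v_pos by (simp_all add: k_def f_def)
  have lt: "k < v" "f < v"
    using v_pos by (simp_all add: k_def f_def nat_less_iff)
  have 1: "?V dvd int f + int k - int s"
  proof -
    have "int f + int k - int s = - ((int s - int k) - (int s - int k) mod ?V)"
      using kf by simp
    thus ?thesis by (metis dvd_minus_iff dvd_minus_mod)
  qed
  have 2: "?V dvd 2 * int k - (int s + e 0 j)"
  proof -
    have "2 * int k - (int s + e 0 j) = (int s + e 0 j) * (2 * h - 1) - 2 * (?x - ?x mod ?V)"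
      using kf by (simp add: algebra_simps)
    moreover have "2 * h - 1 = ?V" using h by simp
    ultimately show ?thesis by (metis dvd_diff dvd_minus_mod dvd_mult dvd_triv_right)
  qed
  have "int k - int f - e 0 j = (2 * int k - (int s + e 0 j)) - (int f + int k - int s)" by simp
  hence "?V dvd int k - int f - e 0 j" using 1 2 by (metis dvd_diff)
  \<comment> \<open>From \<open>f < v\<close> the block index \<open>f div v\<close> is 0.\<close>
  hence "hit f k j" using lt assms by (simp add: hit_def)
  moreover have "int ((f + k) mod v) = int s"
    using 1 assms by (simp add: zmod_int mod_eq_dvd_iff[symmetric])
  hence "(f + k) mod v = s" by linarith
  ultimately show thesis using lt that by blast
qed

section \<open>Cells carrying the same symbol\<close>

lemma hit_congs:
  assumes "(f + k) mod v = (f' + k') mod v" "hit f k j" "hit f' k' j"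
  obtains x y z where "int f + int k - int f' - int k' = int v * x"
    "int k - int f - e (f div v) j = int v * y" "int k' - int f' - e (f' div v) j = int v * z"
proof -
  have "int (f + k) mod int v = int (f' + k') mod int v"
    using assms(1) by (metis zmod_int)
  hence "int v dvd int f + int k - int f' - int k'"
    by (simp add: mod_eq_dvd_iff algebra_simps)
  thus thesis using assms(2,3) that unfolding hit_def dvd_def by blast
qed

lemma eq_if_dvd_diff:
  assumes "k < v" "k' < v" "int v dvd int k - int k'"
  shows "k = k'"
  using assms by (metis mod_eq_dvd_iff mod_less of_nat_eq_iff zmod_int)

text \<open>Different blocks, and not merely different rows, are what the crossing argument
  needs.\<close>

lemma same_symbol_distinct:
  assumes "f < 2 ^ n * v" "f' < 2 ^ n * v" "k < v" "k' < v" "(f, k) \<noteq> (f', k')"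
    and "(f + k) mod v = (f' + k') mod v" "hit f k j" "hit f' k' j"
  shows "f div v \<noteq> f' div v" "k \<noteq> k'"
proof -
  obtain x y z where xyz: "int f + int k - int f' - int k' = int v * x"
    "int k - int f - e (f div v) j = int v * y" "int k' - int f' - e (f' div v) j = int v * z"
    using hit_congs assms(6-8) by blast
  show ne: "f div v \<noteq> f' div v"
  proof
    assume eq: "f div v = f' div v"
    \<comment> \<open>In a common block the \<open>e\<close> terms cancel, so the sum and difference
      congruences combine to twice the column difference.\<close>
    hence "2 * (int k - int k') = int v * (x + y - z)"
      using xyz unfolding eq by (simp add: algebra_simps)
    hence "k = k'"
      using eq_if_dvd_diff assms(3,4) dvd_double_cancel by (metis dvd_triv_left)
    hence "int f mod int v = int f' mod int v"
      using xyz(1) by (simp add: mod_eq_dvd_iff)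
    hence "f mod v = f' mod v" by (metis of_nat_eq_iff zmod_int)
    hence "f = f'" using eq by (metis div_mult_mod_eq)
    thus False using assms(5) \<open>k = k'\<close> by simp
  qed
  show "k \<noteq> k'"
  proof
    assume "k = k'"
    hence "e (f div v) j - e (f' div v) j = int v * (z - y - x)"
      using xyz by (simp add: algebra_simps)
    hence "f div v = f' div v"
      using e_inj_row assms(1,2,7) div_v_less unfolding hit_def by (metis dvd_triv_left)
    thus False using ne by simp
  qed
qed

text \<open>From \<open>f + k = f' + k'\<close> modulo \<open>v\<close>, twice \<open>k' - f\<close>
  is congruent to the sum of \<open>k - f\<close> and \<open>k' - f'\<close>. A hit at the crossing
  cell therefore yields the configuration excluded by \<open>e_midpoint\<close>.\<close>

lemma same_symbol_cross:
  assumes "f < 2 ^ n * v" "f' < 2 ^ n * v" "f div v \<noteq> f' div v"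
    and "(f + k) mod v = (f' + k') mod v" "hit f k j" "hit f' k' j"
  shows "\<not> hit f k' j'"
proof
  assume h: "hit f k' j'"
  obtain x y z where xyz: "int f + int k - int f' - int k' = int v * x"
    "int k - int f - e (f div v) j = int v * y" "int k' - int f' - e (f' div v) j = int v * z"
    using hit_congs assms(4-6) by blast
  obtain w where "int k' - int f - e (f div v) j' = int v * w"
    using h unfolding hit_def dvd_def by blast
  hence "2 * e (f div v) j' - (e (f div v) j + e (f' div v) j) = int v * (y + z - x - 2 * w)"
    using xyz by (simp add: algebra_simps)
  hence "f div v = f' div v"
    using e_midpoint[of "f div v" "f' div v" j j'] h assms(1,2,5) div_v_less
    unfolding hit_def by (metis dvd_triv_left)
  thus False using assms(3) by simp
qed

lemma result_array_pda:
  "pda v (2 ^ n * v) (2 ^ n * v - 2 ^ n * b) (v * b) ({..<v} \<times> {..<b}) (result_array n v m A B)"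
  unfolding pda_def
proof (intro conjI allI impI ballI)
  let ?P = "result_array n v m A B"
  show "?P j k \<in> insert None (Some ` ({..<v} \<times> {..<b}))" if "j < 2 ^ n * v" for j k
  proof (cases "?P j k")
    case (Some p)
    thus ?thesis
      using result_array_Some_iff[OF that, of k "fst p" "snd p"] v_pos
      by (cases p) (auto simp: hit_def)
  qed simp
  show "card {j. j < 2 ^ n * v \<and> ?P j k = None} = 2 ^ n * v - 2 ^ n * b" for k
  proof -
    have "{j. j < 2 ^ n * v \<and> ?P j k = None} = {..<2 ^ n * v} - {f. f < 2 ^ n * v \<and> (\<exists>j. hit f k j)}"
      by (auto simp: result_array_None_iff)
    moreover have "card \<dots> = 2 ^ n * v - 2 ^ n * b"
      by (subst card_Diff_subset) (auto simp: card_hits)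
    ultimately show ?thesis by simp
  qed
  show "\<exists>j<2 ^ n * v. \<exists>k<v. ?P j k = Some p" if mem: "p \<in> {..<v} \<times> {..<b}" for p
  proof -
    obtain s j where p: "p = (s, j)" "s < v" "j < b" using mem by auto
    then obtain f k where fk: "f < v" "k < v" "(f + k) mod v = s" "hit f k j"
      using symbol_occurs by blast
    have "v \<le> 2 ^ n * v" by simp
    hence "f < 2 ^ n * v" using fk(1) by linarith
    thus ?thesis using fk p result_array_Some_iff by metis
  qed
  fix f k f' k'
  assume f: "f < 2 ^ n * v" and k: "k < v" and f': "f' < 2 ^ n * v" and k': "k' < v"
    and eq: "(f, k) \<noteq> (f', k') \<and> ?P f k = ?P f' k' \<and> ?P f k \<noteq> None"
  then obtain p where "?P f k = Some p" by blast
  then obtain s j where "?P f k = Some (s, j)" by (cases p) blast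
  moreover from this have "?P f' k' = Some (s, j)" using eq by simp
  ultimately have h: "(f + k) mod v = (f' + k') mod v" "hit f k j" "hit f' k' j"
    using f f' by (simp_all add: result_array_Some_iff)
  have ne: "f div v \<noteq> f' div v" "k \<noteq> k'"
    using same_symbol_distinct[OF f f' k k' _ h] eq by auto
  show "f \<noteq> f'" "k \<noteq> k'" using ne by auto
  show "?P f k' = None"
    using same_symbol_cross[OF f f' ne(1) h] by (simp add: result_array_None_iff[OF f])
  show "?P f' k = None"
    \<comment> \<open>The other crossing cell follows by exchanging the two positions.\<close>
    using same_symbol_cross[OF f' f ne(1)[symmetric] h(1)[symmetric] h(3,2)]
    by (simp add: result_array_None_iff[OF f'])
qed (simp_all add: card_cartesian_product)

end

section \<open>The coded caching scheme of a placement delivery array\<close>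

text \<open>In characteristic two, interference is removed by adding it once more.\<close>

lemma bit_add_cancel: "(x :: bit) = y + z \<Longrightarrow> x + z = y"
  by (cases y; cases z) simp_all

lemma pda_symbol:
  assumes "pda K F Z S \<Sigma> P" "j < F" "k < K" "P j k = Some s"
  shows "s \<in> \<Sigma>"
proof -
  have "P j k \<in> insert None (Some ` \<Sigma>)"
    using assms(1-3) unfolding pda_def by blast
  thus ?thesis using assms(4) by auto
qed

text \<open>The form of the third PDA condition used in decoding: user \<open>k\<close> has cached
  the packets in all other rows where its symbol occurs.\<close>

lemma pda_cross_None:
  assumes "pda K F Z S \<Sigma> P" "j < F" "k < K" "j' < F" "k' < K"
    and "P j k = Some s" "P j' k' = Some s" "(j, k) \<noteq> (j', k')"
  shows "P j' k = None"
proof -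
  have "(j, k) \<noteq> (j', k') \<and> P j k = P j' k' \<and> P j k \<noteq> None"
    using assms(6-8) by simp
  thus ?thesis
    using assms(1-5) unfolding pda_def by blast
qed

lemma card_cached_pda_scheme:
  assumes "pda K F Z S \<Sigma> P" "k < K"
  shows "card (cached (pda_scheme K N F \<Sigma> P) k) = N * Z"
proof -
  have "cached (pda_scheme K N F \<Sigma> P) k = {..<N} \<times> {j. j < F \<and> P j k = None}"
    by (auto simp: pda_scheme_def)
  thus ?thesis using assms by (simp add: pda_def card_cartesian_product)
qed

lemma cache_size_pda_scheme:
  assumes "pda K F Z S \<Sigma> P" "K > 0"
  shows "cache_size K F (pda_scheme K N F \<Sigma> P) = real N * real Z / real F"
proof -
  have "(\<lambda>k. real (card (cached (pda_scheme K N F \<Sigma> P) k)) / real F) ` {..<K}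
      = (\<lambda>k. real N * real Z / real F) ` {..<K}"
    using card_cached_pda_scheme[OF assms(1)] by (intro image_cong) auto
  also have "\<dots> = {real N * real Z / real F}" using assms(2) by auto
  finally show ?thesis by (simp add: cache_size_def)
qed

lemma load_pda_scheme:
  assumes "pda K F Z S \<Sigma> P" "N > 0"
  shows "load K N F (pda_scheme K N F \<Sigma> P) = real S / real F"
proof -
  \<comment> \<open>The constant demand shows that the maximum is over a nonempty set.\<close>
  have "(\<lambda>_\<in>{..<K}. 0) \<in> demands K N" using assms(2) by (auto simp: demands_def)
  hence "(\<lambda>d. real (card \<Sigma>) / real F) ` demands K N = {real (card \<Sigma>) / real F}" by auto
  thus ?thesis using assms(1) by (simp add: load_def pda_scheme_def pda_def)
qed

lemma coded_caching_scheme_pda_scheme: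
  fixes P :: "'s array"
  assumes pda: "pda K F Z S \<Sigma> P" and "K > 0"
  shows "coded_caching_scheme K (cache_size K F (pda_scheme K N F \<Sigma> P)) N F (pda_scheme K N F \<Sigma> P)"
proof -
  let ?sch = "pda_scheme K N F \<Sigma> P"
  let ?Q = "\<lambda>s. {(j, k). j < F \<and> k < K \<and> P j k = Some s}"
  have finQ: "finite (?Q s)" for s
    by (rule finite_subset[of _ "{..<F} \<times> {..<K}"]) auto
  have "\<exists>dec :: ('s \<Rightarrow> packet) \<Rightarrow> (nat \<times> nat \<Rightarrow> packet) \<Rightarrow> nat \<Rightarrow> packet.
          \<forall>W\<in>libraries N F L. \<forall>j<F.
            dec (\<lambda>s\<in>\<Sigma>. xor_packets L W (coded ?sch d s)) (restrict W (cached ?sch k)) j = W (d k, j)"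
    if d: "d \<in> demands K N" and k: "k < K" for L d k
  proof (intro exI ballI allI impI)
    \<comment> \<open>A starred packet is read from the cache; otherwise the signal of the cell's
      symbol is stripped of its other summands. The library enters only through \<open>sig\<close>
      and \<open>c\<close>.\<close>
    let ?dec = "\<lambda>sig c j. case P j k of None \<Rightarrow> c (d k, j)
      | Some s \<Rightarrow> map (\<lambda>i. sig s ! i + (\<Sum>(j', k')\<in>?Q s - {(j, k)}. c (d k', j') ! i)) [0..<L]"
    fix W j assume W: "W \<in> libraries N F L" and j: "j < F"
    have dN: "d k' < N" if "k' < K" for k' using d that by (auto simp: demands_def)
    let ?c = "restrict W (cached ?sch k)"
    show "?dec (\<lambda>s\<in>\<Sigma>. xor_packets L W (coded ?sch d s)) ?c j = W (d k, j)"
    proof (cases "P j k")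
      case None
      thus ?thesis using j dN[OF k] by (simp add: pda_scheme_def)
    next
      case (Some s)
      \<comment> \<open>Without membership the restricted signal function would return
        \<open>undefined\<close> at \<open>s\<close>.\<close>
      have s: "s \<in> \<Sigma>" using pda_symbol[OF pda j k Some] .
      have side: "?c (d k', j') = W (d k', j')" if "(j', k') \<in> ?Q s - {(j, k)}" for j' k'
      proof -
        have "P j' k = None"
          using that by (intro pda_cross_None[OF pda j k _ _ Some]) auto
        thus ?thesis using that dN by (simp add: pda_scheme_def)
      qed
      have "xor_packets L W (coded ?sch d s) ! i
          + (\<Sum>(j', k')\<in>?Q s - {(j, k)}. ?c (d k', j') ! i) = W (d k, j) ! i" if "i < L" for i
      proof -
        have "xor_packets L W (coded ?sch d s) ! i = (\<Sum>(j', k')\<in>?Q s. W (d k', j') ! i)"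
          using that
          by (simp add: xor_packets_def pda_scheme_def sum_unfold_sum_mset image_mset.compositionality
              o_def case_prod_beta)
        also have "\<dots> = W (d k, j) ! i + (\<Sum>(j', k')\<in>?Q s - {(j, k)}. W (d k', j') ! i)"
          by (subst sum.remove[OF finQ, of "(j, k)"]) (use j k Some in auto)
        also have "(\<Sum>(j', k')\<in>?Q s - {(j, k)}. W (d k', j') ! i)
            = (\<Sum>(j', k')\<in>?Q s - {(j, k)}. ?c (d k', j') ! i)"
        proof (intro sum.cong refl)
          fix x assume "x \<in> ?Q s - {(j, k)}"
          thus "(case x of (j', k') \<Rightarrow> W (d k', j') ! i) = (case x of (j', k') \<Rightarrow> ?c (d k', j') ! i)"
            using side[of "fst x" "snd x"] by (simp only: case_prod_beta prod.collapse)
        qed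
        finally show ?thesis by (rule bit_add_cancel)
      qed
      moreover have "length (W (d k, j)) = L"
        using W j dN[OF k] by (simp add: libraries_def)
      ultimately show ?thesis
        using s Some by (auto intro!: nth_equalityI)
    qed
  qed
  moreover have "set_mset (coded ?sch d s) \<subseteq> {..<N} \<times> {..<F}" if "d \<in> demands K N" for d s
    using that finQ by (auto simp: pda_scheme_def demands_def)
  moreover have "cached ?sch k \<subseteq> {..<N} \<times> {..<F}" for k
    by (auto simp: pda_scheme_def)
  moreover have "real (card (cached ?sch k)) / real F \<le> cache_size K F ?sch" if "k < K" for k
    using card_cached_pda_scheme[OF pda that] cache_size_pda_scheme[OF assms] by simp
  moreover have "signals ?sch d = \<Sigma>" "finite \<Sigma>" for d
    using pda by (simp_all add: pda_scheme_def pda_def)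
  ultimately show ?thesis
    unfolding coded_caching_scheme_def by simp
qed

section \<open>The floored solution and the parameters of its scheme\<close>

theorem theorem4:
  fixes n v :: nat and q :: real and m :: "nat \<Rightarrow> nat" and A B :: "int mat"
    and \<Sigma> :: "(nat \<times> nat) set" and P :: "(nat \<times> nat) array"
  assumes "n \<ge> 1" and "odd v" and "v \<ge> 2 ^ n"
    and "q = real v powr (1 / real n)"
    and "m = (\<lambda>i. nat \<lfloor>q - 1\<rfloor>)"
    and "enumerates_signs n A" and "enumerates_box n m B"
    and "\<Sigma> = {..<v} \<times> {..<(\<Prod>i<n. m i)}"
    and "P = result_array n v m A B"
  shows "feasible n v m \<and>
    relaxed_maximizer n v (\<lambda>i. q - 1) \<and>
    (\<forall>y. relaxed_maximizer n v y \<longrightarrow> (\<forall>i<n. y i = q - 1 \<and> int (m i) = \<lfloor>y i\<rfloor>)) \<and>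
    (\<exists>K F Z S :: nat.
           real K = q ^ n \<and>
           real F = 2 ^ n * q ^ n \<and>
           real Z = 2 ^ n * (q ^ n - of_int \<lfloor>q - 1\<rfloor> ^ n) \<and>
           real S = of_int \<lfloor>q - 1\<rfloor> ^ n * q ^ n \<and>
           pda K F Z S \<Sigma> P \<and>
           (\<forall>N\<ge>1. let sch = pda_scheme K N F \<Sigma> P; M = cache_size K F sch in
              coded_caching_scheme K M N F sch \<and>
              M / real N = 1 - of_int \<lfloor>q - 1\<rfloor> ^ n / q ^ n \<and>
              load K N F sch = (of_int \<lfloor>q - 1\<rfloor> / 2) ^ n))"
proof -
  have v: "v > 0" using assms(2) by (cases v) auto
  have qn: "q ^ n = real v"
    using assms(1) v by (simp add: assms(4) powr_realpow[symmetric] powr_powr)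
  have q0: "q > 0" using v by (simp add: assms(4))
  \<comment> \<open>This is where \<open>v \<ge> 2 ^ n\<close> enters: it makes the floor at least
    1, as positivity of \<open>m\<close> demands.\<close>
  have "q \<ge> 2"
  proof (rule ccontr)
    assume "\<not> q \<ge> 2"
    hence "q ^ n < 2 ^ n" using q0 assms(1) by (intro power_strict_mono) auto
    moreover have "real v \<ge> 2 ^ n" using assms(3) by (metis of_nat_le_iff of_nat_numeral of_nat_power)
    ultimately show False using qn by linarith
  qed
  define \<mu> where "\<mu> = nat \<lfloor>q - 1\<rfloor>"
  have \<mu>: "\<mu> \<ge> 1" "real \<mu> \<le> q - 1" and fl: "\<lfloor>q - 1\<rfloor> = int \<mu>"
    using \<open>q \<ge> 2\<close> by (auto simp: \<mu>_def le_nat_iff le_floor_iff)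
  have m: "m = (\<lambda>i. \<mu>)" using assms(5) by (simp add: \<mu>_def)
  \<comment> \<open>Rounding down keeps the constraint, since \<open>\<mu> + 1 \<le> q\<close> and
    \<open>q ^ n = v\<close>.\<close>
  have "real ((\<mu> + 1) ^ n) \<le> q ^ n"
    unfolding of_nat_power using \<mu> by (intro power_mono) auto
  hence pv: "(\<mu> + 1) ^ n \<le> v" unfolding qn by linarith
  hence feas: "feasible n v m" using \<mu> by (simp add: feasible_def m)
  interpret caching_array n v m A B
    using assms feas by unfold_locales auto
  let ?F = "2 ^ n * v" and ?Z = "2 ^ n * v - 2 ^ n * \<mu> ^ n" and ?S = "v * \<mu> ^ n"
  have P: "pda v ?F ?Z ?S \<Sigma> P"
    using result_array_pda assms(8,9) by (simp add: m)
  \<comment> \<open>The natural-number subtraction in \<open>?Z\<close> must not truncate before it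
    is read as a real difference.\<close>
  have "\<mu> ^ n \<le> (\<mu> + 1) ^ n" by (intro power_mono) auto
  hence "2 ^ n * \<mu> ^ n \<le> ?F" using pv by (intro mult_left_mono) auto
  hence Z: "real ?Z = 2 ^ n * (real v - real \<mu> ^ n)"
    by (simp add: of_nat_diff algebra_simps)
  have "coded_caching_scheme v (cache_size v ?F (pda_scheme v N ?F \<Sigma> P)) N ?F (pda_scheme v N ?F \<Sigma> P)
      \<and> cache_size v ?F (pda_scheme v N ?F \<Sigma> P) / real N = 1 - real \<mu> ^ n / real v
      \<and> load v N ?F (pda_scheme v N ?F \<Sigma> P) = (real \<mu> / 2) ^ n" if "N \<ge> 1" for N
  proof (intro conjI)
    show "cache_size v ?F (pda_scheme v N ?F \<Sigma> P) / real N = 1 - real \<mu> ^ n / real v"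
      unfolding cache_size_pda_scheme[OF P v] Z using that v by (simp add: field_simps)
    show "load v N ?F (pda_scheme v N ?F \<Sigma> P) = (real \<mu> / 2) ^ n"
      using load_pda_scheme[OF P, of N] that v by (simp add: power_divide)
  qed (rule coded_caching_scheme_pda_scheme[OF P v])
  moreover have "\<forall>i<n. y i = q - 1 \<and> int (m i) = \<lfloor>y i\<rfloor>" if "relaxed_maximizer n v y" for y
    using that relaxed_maximizer_iff[OF _ qn] \<open>q \<ge> 2\<close> fl by (simp add: m)
  moreover have "relaxed_maximizer n v (\<lambda>i. q - 1)"
    using relaxed_maximizer_iff[OF _ qn] \<open>q \<ge> 2\<close> by simp
  ultimately show ?thesis
    using feas P Z unfolding Let_def qn fl
    by (intro conjI exI[of _ v] exI[of _ ?F] exI[of _ ?Z] exI[of _ ?S]) (auto simp: mult.commute)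
qed

end
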